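(* Let $q=p^s$ be a prime power which is a perfect square, let $d\ge 2$ with $d\mid(\sqrt q+1)$, and let $\lambda\in\mathbb{F}_q^*$. Suppose there is $\alpha\in\mathbb{F}_q$ with $\alpha^2\in S_d$ and $\lambda\in\alpha^2\mathbb{F}_{\sqrt q}^*$. Let $r$ be the remainder of $\frac{q-1}{d}$ upon division by $p\sqrt q$, and suppose $r\le (p-1)\sqrt q$. Then $MSD_d(\lambda,\mathbb{F}_q)=\sqrt q-1$. If in addition $q\ge 25$ and $d\ge 3$, then $MD_d(\lambda,\mathbb{F}_q)=\sqrt q-1$.
   Context: $p$ is the characteristic of $\mathbb{F}_q$, and $\mathbb{F}_{\sqrt q}$ is the subfield of $\mathbb{F}_q$ of order $\sqrt q$. $S_d=\{x^d:x\in\mathbb{F}_q^*\}$. A set of distinct elements $a_1,\dots,a_m$ of $\mathbb{F}_q^*$ has property $D_d(\lambda,\mathbb{F}_q)$ if $a_ia_j+\lambda\in S_d\cup\{0\}$ whenever $i\ne j$, and property $SD_d(\lambda,\mathbb{F}_q)$ if $a_ia_j+\lambda\in S_d\cup\{0\}$ for all $i,j$ (including $i=j$). $MD_d(\lambda,\mathbb{F}_q)$, $MSD_d(\lambda,\mathbb{F}_q)$ are the maximum sizes of subsets of $\mathbb{F}_q^*$ with these respective properties. *)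

theory Defs
  imports "HOL-Computational_Algebra.Computational_Algebra" "HOL-Library.Cardinality"
begin

definition nonzero_powers :: "nat \<Rightarrow> 'a::field set" where
  "nonzero_powers d = {x ^ d | x. x \<noteq> 0}"

definition is_subfield :: "'a::field set \<Rightarrow> bool" where
  "is_subfield K \<longleftrightarrow>
     0 \<in> K \<and> 1 \<in> K \<and>
     (\<forall>x\<in>K. \<forall>y\<in>K. x + y \<in> K \<and> x * y \<in> K) \<and>
     (\<forall>x\<in>K. - x \<in> K \<and> inverse x \<in> K)"

text \<open>Well defined by \<open>ex1_subfield_sqrt\<close> below whenever \<open>n\<^sup>2\<close> is the order of the ambient
  finite field.\<close>

definition subfield_of_order :: "nat \<Rightarrow> 'a::field set" where
  "subfield_of_order n = (THE K. is_subfield K \<and> card K = n)"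

definition property_D :: "nat \<Rightarrow> 'a::field \<Rightarrow> 'a set \<Rightarrow> bool" where
  "property_D d l A \<longleftrightarrow>
     A \<subseteq> - {0} \<and> (\<forall>a\<in>A. \<forall>b\<in>A. a \<noteq> b \<longrightarrow> a * b + l \<in> nonzero_powers d \<union> {0})"

definition property_SD :: "nat \<Rightarrow> 'a::field \<Rightarrow> 'a set \<Rightarrow> bool" where
  "property_SD d l A \<longleftrightarrow>
     A \<subseteq> - {0} \<and> (\<forall>a\<in>A. \<forall>b\<in>A. a * b + l \<in> nonzero_powers d \<union> {0})"

definition MD :: "nat \<Rightarrow> 'a::finite_field \<Rightarrow> nat" where
  "MD d l = Max {card A | A. property_D d l A}"

definition MSD :: "nat \<Rightarrow> 'a::finite_field \<Rightarrow> nat" where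
  "MSD d l = Max {card A | A. property_SD d l A}"

lemma is_subfield_power_card:
  fixes K :: "'a::finite_field set"
  assumes "is_subfield K" "x \<in> K"
  shows "x ^ card K = x"
proof (cases "x = 0")
  case True
  have "card K > 0"
    using assms(2) by (auto simp: card_gt_0_iff)
  with True show ?thesis by simp
next
  case False
  have Kc: "0 \<in> K" "\<And>u v. u \<in> K \<Longrightarrow> v \<in> K \<Longrightarrow> u * v \<in> K" "\<And>u. u \<in> K \<Longrightarrow> inverse u \<in> K"
    using assms(1) by (auto simp: is_subfield_def)
  have "(\<Prod>y\<in>K-{0}. x * y) = (\<Prod>y\<in>K-{0}. y)"
    by (rule prod.reindex_bij_witness[of _ "\<lambda>y. y * inverse x" "\<lambda>y. x * y"])
       (use False Kc assms(2) in auto)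
  hence "x ^ card (K - {0}) * \<Prod>(K-{0}) = \<Prod>(K-{0})"
    by (simp add: prod.distrib)
  moreover have "\<Prod>(K-{0}) \<noteq> 0"
    by simp
  ultimately have "x ^ card (K - {0}) = 1"
    by simp
  moreover have "card K = Suc (card (K - {0}))"
    using card_Suc_Diff1[OF finite Kc(1)] by simp
  ultimately show ?thesis by simp
qed

lemma card_fixed_points_bound:
  assumes "n \<ge> 2"
  shows "card {x :: 'a::finite_field. x ^ n = x} \<le> n"
proof -
  let ?P = "monom 1 n - monom 1 1 :: 'a poly"
  have "coeff ?P n = 1" using assms by simp
  hence "?P \<noteq> 0" by (metis coeff_0 zero_neq_one)
  hence "card {x. poly ?P x = 0} \<le> degree ?P"
    by (rule card_poly_roots_bound)
  also have "degree ?P \<le> n"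
    by (rule degree_le) (use assms in auto)
  finally show ?thesis by (simp add: poly_monom)
qed

lemma card_fixed_points_sqrt:
  fixes n :: nat
  assumes "n ^ 2 = CARD('a::finite_field)" "n \<ge> 2"
  shows "card {x :: 'a. x ^ n = x} = n"
proof (rule antisym[OF card_fixed_points_bound[OF assms(2)]])
  let ?Q = "\<Sum>i\<le>n. monom 1 ((n - 1) * i) :: 'a poly"
  have cQ: "coeff ?Q ((n - 1) * n) = 1"
  proof -
    have "coeff ?Q ((n - 1) * n) = (\<Sum>i\<le>n. if i = n then 1 else 0)"
      unfolding coeff_sum by (rule sum.cong) (use assms(2) in auto)
    thus ?thesis by simp
  qed
  hence "?Q \<noteq> 0" by (metis coeff_0 zero_neq_one)
  hence "card {x. poly ?Q x = 0} \<le> degree ?Q"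
    by (rule card_poly_roots_bound)
  also have "degree ?Q \<le> (n - 1) * n"
    by (rule degree_sum_le) (auto intro!: order.trans[OF degree_monom_le])
  finally have 1: "card {x. poly ?Q x = 0} \<le> n * n - n"
    by (simp add: diff_mult_distrib)
  have "x \<in> {x. x ^ n = x} \<union> {x. poly ?Q x = 0}" for x :: 'a
  proof -
    have pQ: "poly ?Q x = (\<Sum>i<Suc n. (x ^ (n - 1)) ^ i)"
      by (simp add: poly_sum poly_monom power_mult lessThan_Suc_atMost)
    have exps: "Suc ((n - 1) * Suc n) = n ^ 2" "Suc (n - 1) = n"
      using assms(2) by (cases n; simp add: power2_eq_square)+
    have "x ^ n = x * x ^ (n - 1)"
      by (subst exps(2)[symmetric]) (rule power_Suc)
    hence "x ^ n - x = x * (x ^ (n - 1) - 1)"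
      by (simp add: right_diff_distrib)
    hence "(x ^ n - x) * poly ?Q x = x * ((x ^ (n - 1) - 1) * (\<Sum>i<Suc n. (x ^ (n - 1)) ^ i))"
      by (simp only: pQ mult.assoc)
    also have "\<dots> = x * ((x ^ (n - 1)) ^ Suc n - 1)"
      by (simp only: power_diff_1_eq)
    also have "\<dots> = x ^ Suc ((n - 1) * Suc n) - x"
      by (simp only: power_mult power_Suc right_diff_distrib mult_1_right)
    also have "\<dots> = 0"
      unfolding exps(1) assms(1) by (simp add: finite_field_power_card_eq_same)
    finally show ?thesis by auto
  qed
  hence "UNIV = {x. x ^ n = x} \<union> {x :: 'a. poly ?Q x = 0}"
    by blast
  hence "n * n \<le> card {x :: 'a. x ^ n = x} + card {x :: 'a. poly ?Q x = 0}"
    using card_Un_le[of "{x. x ^ n = x}" "{x :: 'a. poly ?Q x = 0}"] assms(1)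
    by (simp only: power2_eq_square)
  moreover have "n \<le> n * n" by simp
  ultimately show "n \<le> card {x :: 'a. x ^ n = x}"
    using 1 by linarith
qed

lemma ex1_subfield_sqrt:
  fixes n s :: nat
  assumes "n ^ 2 = CARD('a::finite_field)" "CARD('a) = CHAR('a) ^ s"
  shows "\<exists>!K :: 'a set. is_subfield K \<and> card K = n"
proof -
  have "card {0, 1 :: 'a} \<le> CARD('a)"
    by (rule card_mono) auto
  hence "n ^ 2 \<ge> 2" using assms(1) by simp
  hence n2: "n \<ge> 2"
    by (cases "n = 0 \<or> n = 1") auto
  have "n dvd CHAR('a) ^ s"
    unfolding assms(2)[symmetric] assms(1)[symmetric] by simp
  then obtain k where k: "n = CHAR('a) ^ k"
    using divides_primepow_nat[of "CHAR('a)"] by auto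
  have add: "(x + y) ^ n = x ^ n + y ^ n" for x y :: 'a
    by (rule freshmans_dream'[OF CHAR_prime k])
  have neg: "(- x) ^ n = - (x ^ n)" for x :: 'a
  proof -
    have "x ^ n + (- x) ^ n = (x + - x) ^ n"
      by (rule add[symmetric])
    also have "\<dots> = 0"
      using n2 by (simp add: power_0_left)
    finally show ?thesis
      by (rule minus_unique[symmetric])
  qed
  let ?K = "{x :: 'a. x ^ n = x}"
  have "is_subfield ?K"
    unfolding is_subfield_def mem_Collect_eq
    using n2 by (intro conjI ballI)
      (simp_all add: power_0_left add neg power_mult_distrib power_inverse)
  moreover have "card ?K = n"
    by (rule card_fixed_points_sqrt[OF assms(1) n2])
  moreover have "K = ?K" if "is_subfield K" "card K = n" for K
  proof (rule card_seteq)
    show "K \<subseteq> ?K" using is_subfield_power_card[OF that(1)] that(2) by auto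
    show "card ?K \<le> card K" unfolding that(2) by (rule card_fixed_points_bound[OF n2])
  qed simp
  ultimately show ?thesis by blast
qed

end

theory Submission
  imports Defs
begin

text \<open>
  Let \<open>n = \<surd>q\<close>, \<open>k = (n + 1) / d\<close>, and write \<open>z \<mapsto> z\<^sup>n\<close> for the conjugation of \<open>\<bbbF>\<^sub>q\<close> over \<open>\<bbbF>\<^sub>n\<close>.
  The set \<open>\<alpha>\<bbbF>\<^sub>n\<^sup>*\<close> gives the lower bound, because every element of \<open>\<bbbF>\<^sub>n\<^sup>*\<close> is a norm
  \<open>y\<^bsup>n+1\<^esup>\<close> and hence a \<open>d\<close>-th power. For the upper bound, divide by \<open>\<alpha>\<close> so that
  \<open>\<lambda>\<close> becomes some \<open>c \<in> \<bbbF>\<^sub>n\<^sup>*\<close>. If \<open>z = x\<^sup>d\<close> or \<open>z = 0\<close>, then \<open>z\<^sup>k\<close> is a norm or zero, so it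
  is fixed by conjugation. Given \<open>k\<close> elements \<open>b\<close>, interpolation yields weights \<open>w\<^sub>b\<close> for which
  \<open>\<Sum>\<^sub>b w\<^sub>b ((ab + c)\<^sup>k - c\<^sup>k)\<close> is a nonzero multiple of \<open>a\<close>. Conjugating this identity, every
  \<open>a\<close> for which all \<open>ab + c\<close> are \<open>d\<close>-th powers or zero satisfies \<open>a\<^sup>n = h(a)\<close> for a fixed
  polynomial \<open>h\<close> of degree at most \<open>k < n\<close> with \<open>h(0) = 0\<close>; there are at most \<open>n - 1\<close> such
  \<open>a \<noteq> 0\<close>. When the condition is only known for \<open>a \<noteq> b\<close> and the set has at least \<open>2k + 1\<close>
  elements, \<open>h\<close> does not change when one \<open>b\<close> is exchanged, so all elements satisfy the equation.
\<close>

text \<open>The weights are the Lagrange basis polynomials of \<open>B\<close> evaluated at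
  \<open>x0\<close>. They depend only on \<open>B\<close> and \<open>x0\<close>, so one choice
  serves all \<open>f\<close> of small degree.\<close>

lemma lagrange_evaluation:
  fixes B :: "'a::field set" and x0 :: 'a
  assumes "finite B"
  obtains w where "\<And>f. degree f < card B \<Longrightarrow> (\<Sum>b\<in>B. w b * poly f b) = poly f x0"
proof -
  define L where "L b = (\<Prod>e\<in>B-{b}. smult (inverse (b - e)) [:-e, 1:])" for b
  have L_same: "poly (L b) b = 1" for b
    unfolding L_def poly_prod 
  proof (intro prod.neutral ballI)
    fix e assume "e \<in> B - {b}"
    hence "inverse (b - e) * (b - e) = 1" by (intro left_inverse) auto
    thus "poly (smult (inverse (b - e)) [:-e, 1:]) b = 1" by (simp add: algebra_simps)
  qed
  have L_other: "poly (L b) e = 0" if "b \<in> B" "e \<in> B" "e \<noteq> b" for b e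
    using that assms by (auto simp: L_def poly_prod)
  have deg_L: "degree (L b) \<le> card B - 1" if "b \<in> B" for b
  proof -
    have "degree (L b) \<le> (\<Sum>e\<in>B-{b}. (degree \<circ> (\<lambda>e. smult (inverse (b - e)) [:-e, 1:])) e)"
      unfolding L_def using assms by (intro degree_prod_sum_le) auto
    also have "\<dots> \<le> (\<Sum>e\<in>B-{b}. 1)"
      by (intro sum_mono) simp
    also have "\<dots> = card B - 1"
      using that assms by simp
    finally show ?thesis .
  qed
  have "(\<Sum>b\<in>B. poly (L b) x0 * poly f b) = poly f x0" if f: "degree f < card B" for f
  proof -
    let ?g = "\<Sum>b\<in>B. smult (poly f b) (L b)"
    have "poly ?g e = poly f e" if "e \<in> B" for e
    proof -
      have "poly ?g e = (\<Sum>b\<in>B. if b = e then poly f e else 0)"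
        unfolding poly_sum using that by (intro sum.cong) (auto simp: L_same L_other)
      thus ?thesis using that assms by simp
    qed
    moreover have "degree ?g \<le> card B - 1"
      using assms deg_L by (intro degree_sum_le) (auto intro: order.trans[OF degree_smult_le])
    hence "degree ?g < card B" using f by linarith
    ultimately have "?g = f"
      using f by (intro poly_eqI_degree[of B]) auto
    hence "poly f x0 = poly ?g x0" by simp
    thus ?thesis by (simp add: poly_sum mult.commute)
  qed
  thus thesis by (rule that)
qed

text \<open>As a polynomial in b, the difference of powers is b times a polynomial f of degree below
  \<open>card B\<close>. Dividing the weights for evaluation at 0 by b leaves f(0), which is linear
  in a.\<close>

lemma power_sum_isolates_linear_term:
  fixes B :: "'a::field set" and c :: 'a
  assumes "finite B" "0 \<notin> B" "card B > 0"
  obtains w where "\<And>a. (\<Sum>b\<in>B. w b * ((a * b + c) ^ card B - c ^ card B)) =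
                      of_nat (card B) * c ^ (card B - 1) * a"
proof -
  let ?k = "card B"
  obtain w where w: "\<And>f. degree f < ?k \<Longrightarrow> (\<Sum>b\<in>B. w b * poly f b) = poly f 0"
    using lagrange_evaluation[OF assms(1)] by blast
  have "(\<Sum>b\<in>B. (w b / b) * ((a * b + c) ^ ?k - c ^ ?k)) = of_nat ?k * c ^ (?k - 1) * a" for a
  proof -
    \<comment> \<open>The geometric-sum cofactor from factoring
      \<open>(a * b + c) ^ ?k - c ^ ?k\<close>, read as a polynomial in b with a fixed.\<close>
    define f where "f = smult a (\<Sum>i<?k. smult (c ^ (?k - Suc i)) ([:c, a:] ^ i))"
    have "degree f \<le> ?k - 1"
      unfolding f_def
      by (intro order.trans[OF degree_smult_le] degree_sum_le order.trans[OF degree_power_le])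
         (auto intro!: order.trans[OF mult_le_mono1[of _ 1]])
    hence deg: "degree f < ?k" using assms(3) by linarith
    have "(w b / b) * ((a * b + c) ^ ?k - c ^ ?k) = w b * poly f b" if "b \<in> B" for b
    proof -
      have "b \<noteq> 0" using that assms(2) by auto
      moreover have "(a * b + c) ^ ?k - c ^ ?k = b * poly f b"
        unfolding power_diff_sumr2 f_def
        by (simp add: poly_sum poly_power algebra_simps)
      ultimately show ?thesis by simp
    qed
    hence "(\<Sum>b\<in>B. (w b / b) * ((a * b + c) ^ ?k - c ^ ?k)) = poly f 0"
      using w[OF deg] by simp
    also have "\<dots> = a * (\<Sum>i<?k. c ^ (?k - 1))"
    proof -
      have "c ^ (?k - Suc i) * c ^ i = c ^ (?k - 1)" if "i < ?k" for i
        using that by (simp flip: power_add)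
      thus ?thesis
        unfolding f_def by (simp add: poly_sum poly_power)
    qed
    finally show ?thesis by (simp add: mult_ac)
  qed
  thus thesis by (rule that)
qed

lemma power_sqrt_card_add:
  fixes x y :: "'a::finite_field"
  assumes "n ^ 2 = CARD('a)" "CARD('a) = CHAR('a) ^ s"
  shows "(x + y) ^ n = x ^ n + y ^ n"
proof -
  have "n dvd CHAR('a) ^ s"
    unfolding assms(2)[symmetric] assms(1)[symmetric] by simp
  then obtain k where "n = CHAR('a) ^ k"
    using divides_primepow_nat[of "CHAR('a)"] by auto
  thus ?thesis by (rule freshmans_dream'[OF CHAR_prime])
qed

lemma of_nat_sqrt_card:
  assumes "n ^ 2 = CARD('a::finite_field)" "CARD('a) = CHAR('a) ^ s"
  shows "of_nat n = (0 :: 'a)"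
proof -
  have "card {0, 1 :: 'a} \<le> CARD('a)"
    by (rule card_mono) auto
  \<comment> \<open>Only the square of \<open>n\<close> is given as a power of the characteristic,
    so vanishing is shown for the square first.\<close>
  hence "s \<noteq> 0" using assms(2) by (intro notI) simp
  hence "(of_nat n :: 'a) ^ 2 = 0"
    unfolding of_nat_power[symmetric] assms by simp
  thus ?thesis by simp
qed

text \<open>Raising the isolated linear term to the power \<open>n\<close> conjugates the weights
  but leaves the fixed values \<open>(a * b + c) ^ card B\<close> alone. So the right side stays a
  polynomial in a, and it depends only on \<open>B\<close> and \<open>c\<close>.\<close>

lemma conjugate_polynomial:
  fixes B :: "'a::field set" and c :: 'a
  assumes add: "\<And>x y :: 'a. (x + y) ^ n = x ^ n + y ^ n" and n: "n > 0"
    and B: "finite B" "0 \<notin> B" "card B > 0" "of_nat (card B) \<noteq> (0 :: 'a)"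
    and c: "c \<noteq> 0" "c ^ n = c"
  obtains h where "degree h \<le> card B" "poly h 0 = 0"
    "\<And>a. (\<And>b. b \<in> B \<Longrightarrow> ((a * b + c) ^ card B) ^ n = (a * b + c) ^ card B) \<Longrightarrow>
        a ^ n = poly h a"
proof -
  let ?k = "card B"
  obtain w where w: "\<And>a. (\<Sum>b\<in>B. w b * ((a * b + c) ^ ?k - c ^ ?k)) =
                      of_nat ?k * c ^ (?k - 1) * a"
    using power_sum_isolates_linear_term[OF B(1-3)] by blast
  have sum_power: "(\<Sum>b\<in>X. g b) ^ n = (\<Sum>b\<in>X. g b ^ n)" for g :: "'a \<Rightarrow> 'a" and X
    by (induction X rule: infinite_finite_induct) (use n in \<open>auto simp: add\<close>)
  have diff_power: "(x - y) ^ n = x ^ n - y ^ n" for x y :: 'a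
    using add[of "x - y" y] by simp
  define m where "m = (of_nat ?k * c ^ (?k - 1)) ^ n"
  have m: "m \<noteq> 0" using B c by (simp add: m_def)
  define h where
    "h = smult (inverse m) (\<Sum>b\<in>B. smult (w b ^ n) ([:c, b:] ^ ?k - [:c ^ ?k:]))"
  have "degree ([:c, b:] ^ ?k - [:c ^ ?k:]) \<le> ?k" for b
    by (intro degree_diff_le order.trans[OF degree_power_le]) auto
  hence "degree h \<le> ?k"
    unfolding h_def using B(1)
    by (intro order.trans[OF degree_smult_le] degree_sum_le) auto
  moreover have "poly h 0 = 0"
    by (simp add: h_def poly_sum poly_power)
  moreover have "a ^ n = poly h a"
    if a: "\<And>b. b \<in> B \<Longrightarrow> ((a * b + c) ^ ?k) ^ n = (a * b + c) ^ ?k" for a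
  proof -
    have ck: "(c ^ ?k) ^ n = c ^ ?k"
      using c(2) by (metis power_mult mult.commute)
    have "m * a ^ n = (\<Sum>b\<in>B. w b * ((a * b + c) ^ ?k - c ^ ?k)) ^ n"
      unfolding w m_def by (rule power_mult_distrib[symmetric])
    also have "\<dots> = (\<Sum>b\<in>B. w b ^ n * ((a * b + c) ^ ?k - c ^ ?k))"
      unfolding sum_power power_mult_distrib[of "w _"] diff_power ck
      using a by (intro sum.cong) auto
    also have "\<dots> = m * poly h a"
      using m by (simp add: h_def poly_sum poly_power field_simps add.commute)
    finally show ?thesis using m by simp
  qed
  ultimately show thesis by (rule that)
qed

text \<open>All of \<open>A\<close> consists of roots of X^n - h, and 0 is a further root, which
  makes the inequality strict.\<close>

lemma card_power_eq_poly:
  fixes A :: "'a::field set"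
  assumes "degree h < n" "poly h 0 = 0" "finite A" "0 \<notin> A" "\<And>a. a \<in> A \<Longrightarrow> a ^ n = poly h a"
  shows "card A < n"
proof -
  let ?g = "monom 1 n - h"
  have "coeff ?g n = 1" using assms(1) by (simp add: coeff_eq_0)
  hence g: "?g \<noteq> 0" by (metis coeff_0 zero_neq_one)
  have "insert 0 A \<subseteq> {x. poly ?g x = 0}"
    using assms by (auto simp: poly_monom)
  hence "card (insert 0 A) \<le> card {x. poly ?g x = 0}"
    using poly_roots_finite[OF g] by (intro card_mono)
  also have "\<dots> \<le> degree ?g" by (rule card_poly_roots_bound[OF g])
  also have "\<dots> \<le> n" using assms(1) by (intro degree_diff_le degree_monom_le) auto
  finally show ?thesis using assms by simp
qed

lemma card_product_shift_fixed_powers: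
  fixes A :: "'a::field set" and c :: 'a
  assumes add: "\<And>x y :: 'a. (x + y) ^ n = x ^ n + y ^ n"
    and k: "0 < k" "k < n" "of_nat k \<noteq> (0 :: 'a)"
    and A: "finite A" "0 \<notin> A"
    and c: "c \<noteq> 0" "c ^ n = c"
    and fixed: "\<And>a b. a \<in> A \<Longrightarrow> b \<in> A \<Longrightarrow> ((a * b + c) ^ k) ^ n = (a * b + c) ^ k"
  shows "card A < n"
proof (rule ccontr)
  assume "\<not> card A < n"
  then obtain B where B: "B \<subseteq> A" "card B = k" "finite B"
    using k A by (metis obtain_subset_with_card_n le_trans less_imp_le not_less)
  obtain h where "degree h \<le> card B" "poly h 0 = 0"
    "\<And>a. (\<And>b. b \<in> B \<Longrightarrow> ((a * b + c) ^ card B) ^ n = (a * b + c) ^ card B) \<Longrightarrow>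
        a ^ n = poly h a"
    using conjugate_polynomial[OF add _ B(3) _ _ _ c] A B k
    by (metis subsetD gr_zeroI not_less_zero)
  hence "card A < n"
    using A B k fixed by (intro card_power_eq_poly[of h]) auto
  with \<open>\<not> card A < n\<close> show False by simp
qed

text \<open>A polynomial built from \<open>B\<close> controls only a outside \<open>B\<close>, since
  nothing is known about a = b. Exchanging one element of \<open>B\<close> for an outside element
  frees it, and the two polynomials agree at too many points to differ.\<close>

lemma card_distinct_product_shift_fixed_powers:
  fixes A :: "'a::field set" and c :: 'a
  assumes add: "\<And>x y :: 'a. (x + y) ^ n = x ^ n + y ^ n"
    and k: "0 < k" "2 * k < n" "of_nat k \<noteq> (0 :: 'a)"
    and A: "finite A" "0 \<notin> A"
    and c: "c \<noteq> 0" "c ^ n = c"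
    and fixed: "\<And>a b. a \<in> A \<Longrightarrow> b \<in> A \<Longrightarrow> a \<noteq> b \<Longrightarrow>
                  ((a * b + c) ^ k) ^ n = (a * b + c) ^ k"
  shows "card A < n"
proof (rule ccontr)
  assume "\<not> card A < n"
  hence cardA: "2 * k < card A" using k by linarith
  have ex: "\<exists>h. degree h \<le> k \<and> poly h 0 = 0 \<and> (\<forall>a\<in>A-B. a ^ n = poly h a)"
    if B: "B \<subseteq> A" "card B = k" for B
  proof -
    have "finite B" "0 \<notin> B" "0 < n"
      using B A k by (auto dest: finite_subset)
    then obtain h where h: "degree h \<le> card B" "poly h 0 = 0"
      "\<And>a. (\<And>b. b \<in> B \<Longrightarrow> ((a * b + c) ^ card B) ^ n = (a * b + c) ^ card B) \<Longrightarrow>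
          a ^ n = poly h a"
      using conjugate_polynomial[OF add _ _ _ _ _ c] B k by metis
    moreover have "a ^ n = poly h a" if "a \<in> A - B" for a
      using that B fixed by (intro h(3)) (metis DiffE subsetD)
    ultimately show ?thesis using B by auto
  qed
  obtain B where B: "B \<subseteq> A" "card B = k" "finite B"
    using cardA A obtain_subset_with_card_n[of k A] by auto
  obtain h where h: "degree h \<le> k" "poly h 0 = 0" "\<And>a. a \<in> A - B \<Longrightarrow> a ^ n = poly h a"
    using ex[OF B(1,2)] by blast
  have "card (A - B) > 0" using B cardA A by (simp add: card_Diff_subset)
  then obtain e where e: "e \<in> A - B" by (auto simp: card_gt_0_iff)
  have "b ^ n = poly h b" if b: "b \<in> B" for b
  proof -
    let ?B' = "insert e (B - {b})"
    have "?B' \<subseteq> A" using B e by auto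
    moreover have "card ?B' = Suc (card (B - {b}))"
      using B e by (intro card_insert_disjoint) auto
    hence "card ?B' = k"
      using card_Suc_Diff1[OF B(3) b] B(2) by simp
    ultimately obtain h' where h': "degree h' \<le> k" "poly h' 0 = 0"
      "\<And>a. a \<in> A - ?B' \<Longrightarrow> a ^ n = poly h' a"
      using ex[of ?B'] by blast
    \<comment> \<open>At least k elements of \<open>A\<close> avoid both sets; with 0 this gives k +
      1 points, enough to determine a polynomial of degree at most k.\<close>
    let ?R = "insert 0 (A - insert e B)"
    have "card (A - insert e B) = card A - Suc k"
      using A B e by (subst card_Diff_subset) auto
    hence "k < card ?R" using A cardA by simp
    moreover have "poly h x = poly h' x" if "x \<in> ?R" for x
    proof (cases "x = 0")
      case False
      hence "x ^ n = poly h x" "x ^ n = poly h' x"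
        using that h(3)[of x] h'(3)[of x] by auto
      thus ?thesis by simp
    qed (use h h' in simp)
    ultimately have "h = h'"
      using h h' by (intro poly_eqI_degree[of ?R]) auto
    moreover have "b \<in> A - ?B'" using b B e by auto
    ultimately show ?thesis using h'(3) by blast
  qed
  hence "card A < n"
    using A k h by (intro card_power_eq_poly[of h]) auto
  with \<open>\<not> card A < n\<close> show False by simp
qed

text \<open>The norm maps the n^2 - 1 nonzero elements into the n - 1 nonzero fixed points, with
  fibres of size at most n + 1, so counting forces surjectivity.\<close>

lemma fixed_by_conjugation_is_norm:
  fixes c :: "'a::finite_field"
  assumes n: "n ^ 2 = CARD('a)" "n \<ge> 2" and c: "c ^ n = c" "c \<noteq> 0"
  obtains y where "y \<noteq> 0" "y ^ (n + 1) = c"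
proof -
  let ?N = "\<lambda>y :: 'a. y ^ (n + 1)"
  let ?I = "?N ` (UNIV - {0})" and ?F = "{x :: 'a. x ^ n = x} - {0}"
  have norm: "?N y ^ n = ?N y" for y
  proof -
    have "?N y ^ n = y ^ (n ^ 2) * y ^ n"
      by (simp add: power_mult_distrib power_mult power2_eq_square mult.commute)
    thus ?thesis
      unfolding n(1) by (simp add: finite_field_power_card_eq_same)
  qed
  have "?I \<subseteq> ?F" using norm by auto
  moreover have "card ?F \<le> card ?I"
  proof -
    have fibre: "card {y. ?N y = z} \<le> n + 1" for z
    proof -
      let ?P = "monom 1 (n + 1) - [:z:]"
      have "coeff ?P (n + 1) = 1" by simp
      hence "?P \<noteq> 0" by (metis coeff_0 zero_neq_one)
      hence "card {y. poly ?P y = 0} \<le> degree ?P" by (rule card_poly_roots_bound)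
      also have "\<dots> \<le> n + 1" by (intro degree_diff_le degree_monom_le) auto
      finally show ?thesis by (simp add: poly_monom)
    qed
    have "n ^ 2 - 1 = card (UNIV - {0 :: 'a})" using n by simp
    also have "\<dots> \<le> card (\<Union>z\<in>?I. {y. ?N y = z})"
      by (intro card_mono) auto
    also have "\<dots> \<le> (\<Sum>z\<in>?I. card {y. ?N y = z})"
      by (intro card_UN_le) auto
    also have "\<dots> \<le> (\<Sum>z\<in>?I. n + 1)"
      using fibre by (rule sum_mono)
    also have "\<dots> = card ?I * (n + 1)"
      by simp
    finally have "n ^ 2 - 1 \<le> card ?I * (n + 1)" .
    moreover have "n ^ 2 - 1 = (n - 1) * (n + 1)"
      by (simp add: power2_eq_square algebra_simps)
    ultimately have "n - 1 \<le> card ?I" by (metis mult_le_cancel2 add_gr_0 zero_less_one)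
    moreover have "card ?F = n - 1"
      using card_fixed_points_sqrt[OF n] n(2) by (simp add: card_Diff_singleton)
    ultimately show ?thesis by simp
  qed
  ultimately have "?I = ?F" by (intro card_seteq) auto
  hence "c \<in> ?I" using c by simp
  thus thesis using that by auto
qed

theorem theorem1p5:
  fixes p q s sqrt_q d r :: nat and l :: "'a::finite_field"
  assumes "p = CHAR('a)" and "q = CARD('a)" and "q = p ^ s"
    and "q = sqrt_q ^ 2"
    and "d \<ge> 2" and "d dvd sqrt_q + 1"
    and "l \<noteq> 0"
    and "\<exists>\<alpha>. \<alpha> ^ 2 \<in> nonzero_powers d \<and>
           l \<in> {\<alpha> ^ 2 * c | c. c \<in> subfield_of_order sqrt_q - {0}}"
    and "r = ((q - 1) div d) mod (p * sqrt_q)"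
    and "r \<le> (p - 1) * sqrt_q"
  shows "MSD d l = sqrt_q - 1 \<and>
         (q \<ge> 25 \<and> d \<ge> 3 \<longrightarrow> MD d l = sqrt_q - 1)"
proof -
  define n where "n = sqrt_q"
  have card: "n ^ 2 = CARD('a)" "CARD('a) = CHAR('a) ^ s"
    using assms(1-4) by (simp_all add: n_def)
  have "card {0, 1 :: 'a} \<le> CARD('a)"
    by (rule card_mono) auto
  hence "n ^ 2 \<ge> 2" using card(1) by simp
  hence n2: "n \<ge> 2"
    by (cases "n = 0 \<or> n = 1") auto
  have add: "(x + y) ^ n = x ^ n + y ^ n" for x y :: 'a
    using card by (rule power_sqrt_card_add)
  obtain k where k: "n + 1 = d * k"
    using assms(6) unfolding n_def by (rule dvdE)
  have k0: "0 < k" using k by (cases k) auto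
  have "2 * k \<le> n + 1" using mult_le_mono1[OF assms(5), of k] k by simp
  hence kn: "k < n" using n2 by linarith
  \<comment> \<open>In the field d k = n + 1 = 1, so k is invertible there.\<close>
  have "(of_nat d * of_nat k :: 'a) = of_nat (n + 1)" unfolding k by simp
  also have "\<dots> = 1" using of_nat_sqrt_card[OF card] by simp
  finally have kp: "of_nat k \<noteq> (0 :: 'a)" by auto
  define K where "K = (subfield_of_order n :: 'a set)"
  have K: "is_subfield K" "card K = n"
    using theI'[OF ex1_subfield_sqrt[OF card]] by (simp_all add: K_def subfield_of_order_def)
  have K_fixed: "x ^ n = x" if "x \<in> K" for x
    using is_subfield_power_card[OF K(1) that] K(2) by simp
  obtain \<alpha> c where \<alpha>: "\<alpha> ^ 2 \<in> nonzero_powers d" and l: "l = \<alpha> ^ 2 * c" and c: "c \<in> K" "c \<noteq> 0"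
    using assms(8) by (auto simp: K_def n_def)
  obtain u where u: "\<alpha> ^ 2 = u ^ d" "u \<noteq> 0" using \<alpha> by (auto simp: nonzero_powers_def)
  have \<alpha>0: "\<alpha> \<noteq> 0" using u by (auto simp: power_0_left)
  have K_powers: "x \<in> nonzero_powers d" if "x \<in> K" "x \<noteq> 0" for x
  proof -
    obtain y where "y \<noteq> 0" "y ^ (n + 1) = x"
      using fixed_by_conjugation_is_norm[OF card(1) n2 K_fixed] \<open>x \<in> K\<close> \<open>x \<noteq> 0\<close> by blast
    hence "x = (y ^ k) ^ d" "y ^ k \<noteq> 0"
      unfolding k by (simp_all add: mult.commute flip: power_mult)
    thus ?thesis unfolding nonzero_powers_def by blast
  qed
  have fixed: "(x ^ k) ^ n = x ^ k" if x: "\<alpha> ^ 2 * x \<in> nonzero_powers d \<union> {0}" for x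
  proof (cases "x = 0")
    case True
    thus ?thesis using k0 n2 by (simp add: power_0_left)
  next
    case False
    then obtain v where "\<alpha> ^ 2 * x = v ^ d"
      using x \<alpha>0 by (auto simp: nonzero_powers_def)
    \<comment> \<open>Since \<alpha>^2 is itself a d-th power, it can be divided out; then
      \<open>x ^ k\<close> is the norm of \<open>v / u\<close>.\<close>
    hence "x = (v / u) ^ d" using u by (simp add: power_divide field_simps)
    hence xk: "x ^ k = (v / u) ^ (n + 1)" unfolding k by (simp flip: power_mult)
    have "((v / u) ^ (n + 1)) ^ n = (v / u) ^ (n ^ 2) * (v / u) ^ n"
      by (simp only: power_add power_one_right power_mult_distrib power_mult power2_eq_square
            mult.commute)
    also have "\<dots> = (v / u) ^ (n + 1)"
      unfolding card(1) finite_field_power_card_eq_same by simp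
    finally show ?thesis unfolding xk .
  qed
  have scaled: "\<alpha> ^ 2 * (a * b + c) = (\<alpha> * a) * (\<alpha> * b) + l" for a b
    by (simp add: l power2_eq_square algebra_simps)
  have card_scaled: "card ((\<lambda>a. a / \<alpha>) ` A) = card A" for A
    using \<alpha>0 by (intro card_image) (auto simp: inj_on_def)
  have SD_le: "card A \<le> n - 1" if "property_SD d l A" for A
  proof -
    have "card ((\<lambda>a. a / \<alpha>) ` A) < n"
    proof (rule card_product_shift_fixed_powers[OF add k0 kn kp _ _ c(2) K_fixed[OF c(1)]])
      fix a b assume "a \<in> (\<lambda>a. a / \<alpha>) ` A" "b \<in> (\<lambda>a. a / \<alpha>) ` A"
      hence "\<alpha> * a \<in> A" "\<alpha> * b \<in> A" using \<alpha>0 by auto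
      thus "((a * b + c) ^ k) ^ n = (a * b + c) ^ k"
        using that by (intro fixed) (unfold scaled property_SD_def, blast)
    qed (use that \<alpha>0 in \<open>auto simp: property_SD_def\<close>)
    thus ?thesis unfolding card_scaled by linarith
  qed
  have D_le: "card A \<le> n - 1" if "property_D d l A" "q \<ge> 25" "d \<ge> 3" for A
  proof -
    have "5 ^ 2 \<le> n ^ 2" using that(2) assms(2) card by simp
    hence "5 \<le> n" by (rule power2_le_imp_le) simp
    \<comment> \<open>The exchange argument needs 2k < n, which is where \<open>d \<ge> 3\<close>
      enters.\<close>
    moreover have "3 * k \<le> n + 1" using mult_le_mono1[OF that(3), of k] k by simp
    ultimately have kn2: "2 * k < n" by linarith
    have "card ((\<lambda>a. a / \<alpha>) ` A) < n"
    proof (rule card_distinct_product_shift_fixed_powers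
        [OF add k0 kn2 kp _ _ c(2) K_fixed[OF c(1)]])
      fix a b assume "a \<in> (\<lambda>a. a / \<alpha>) ` A" "b \<in> (\<lambda>a. a / \<alpha>) ` A" "a \<noteq> b"
      hence "\<alpha> * a \<in> A" "\<alpha> * b \<in> A" using \<alpha>0 by auto
      thus "((a * b + c) ^ k) ^ n = (a * b + c) ^ k"
        using that(1) \<open>a \<noteq> b\<close> \<alpha>0
        by (intro fixed) (unfold scaled property_D_def, metis mult_left_cancel)
    qed (use that(1) \<alpha>0 in \<open>auto simp: property_D_def\<close>)
    thus ?thesis unfolding card_scaled by linarith
  qed
  \<comment> \<open>The extremal set: products of its elements shifted by \<open>l\<close> are
    \<alpha>^2 times an element of the subfield, hence zero or a product of two d-th powers.\<close>
  define E where "E = (\<lambda>x. \<alpha> * x) ` (K - {0})"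
  have "card E = card (K - {0})"
    unfolding E_def using \<alpha>0 by (intro card_image) (auto simp: inj_on_def)
  also have "\<dots> = n - 1"
    using K by (simp add: is_subfield_def card_Diff_singleton)
  finally have cardE: "card E = n - 1" .
  have "(\<alpha> * x) * (\<alpha> * y) + l \<in> nonzero_powers d \<union> {0}" if "x \<in> K" "y \<in> K" for x y
  proof -
    have z: "x * y + c \<in> K" using K(1) that c by (simp add: is_subfield_def)
    show ?thesis
    proof (cases "x * y + c = 0")
      case True
      thus ?thesis unfolding scaled[symmetric] by simp
    next
      case False
      then obtain v where "x * y + c = v ^ d" "v \<noteq> 0"
        using K_powers[OF z] by (auto simp: nonzero_powers_def)
      hence "\<alpha> ^ 2 * (x * y + c) = (u * v) ^ d" "u * v \<noteq> 0"
        using u by (simp_all add: power_mult_distrib)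
      thus ?thesis unfolding scaled[symmetric] nonzero_powers_def by blast
    qed
  qed
  hence E: "property_SD d l E"
    using \<alpha>0 by (auto simp: property_SD_def E_def)
  hence E': "property_D d l E"
    by (auto simp: property_SD_def property_D_def)
  have "MSD d l = n - 1"
    unfolding MSD_def
  proof (rule Max_eqI)
    show "n - 1 \<in> {card A | A. property_SD d l A}" using E cardE by force
  qed (use SD_le in auto)
  moreover have "MD d l = n - 1" if "q \<ge> 25" "d \<ge> 3"
    unfolding MD_def
  proof (rule Max_eqI)
    show "n - 1 \<in> {card A | A. property_D d l A}" using E' cardE by force
  qed (use D_le that in auto)
  ultimately show ?thesis by (simp add: n_def)
qed

end
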